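(* Let $H^{complex}=(H_{r,s})_{r,s\ge 0}$ be the double sequence of univariate complex Hermite polynomials. For every $M=(m,n,m',n')$ of non-negative integers and all $(z,w)\in\mathbb{C}^2$, $$H_{m,n,m',n'}(z,w)=\frac{1}{\sqrt{2}^{\,|M|}}\,\mathcal{B}^{(4,2)}_M(H^{complex})(\sqrt{2}\,z,\sqrt{2}\,w).$$
   Context: For integers $m,n\ge 0$ and $\zeta\in\mathbb{C}$, $H_{m,n}(\zeta,\overline{\zeta})=(-1)^{m+n}e^{|\zeta|^2}\frac{\partial^{m+n}}{\partial\overline{\zeta}^{m}\partial\zeta^{n}}\left(e^{-|\zeta|^2}\right)$ (Wirtinger derivatives), and for $(z,w)\in\mathbb{C}^2$, $H_{m,n,m',n'}(z,w)=H_{m,n}(z+iw,\overline{z}-i\overline{w})\,H_{m',n'}(\overline{z}+i\overline{w},z-iw)$. For $M=(m,n,m',n')$ put $|M|=m+n+m'+n'$. For a double sequence $f=(f_{r,s})_{r,s\ge 0}$ of functions on $\mathbb{C}$, the $(4,2)$-binomial operator is $$\mathcal{B}^{(4,2)}_M(f)(z,w)=\sum_{J=0}^{M}(-1)^{k+k'}i^{|J|}\binom{M}{J}f_{m+n'-j-k',\,m'+n-j'-k}(z,\overline{z})\,f_{j+k',\,j'+k}(w,\overline{w}),$$ where $J=(j,k,j',k')$ runs over $0\le j\le m$, $0\le k\le n$, $0\le j'\le m'$, $0\le k'\le n'$, $|J|=j+k+j'+k'$ and $\binom{M}{J}=\binom{m}{j}\binom{n}{k}\binom{m'}{j'}\binom{n'}{k'}$.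 *)

theory Defs
  imports "HOL-Analysis.Analysis"
begin

text \<open>
  Wirtinger derivatives of a function that is smooth in the real sense,
  \<open>\<partial>/\<partial>\<zeta> = (\<partial>/\<partial>x - \<i> \<partial>/\<partial>y) / 2\<close> and \<open>\<partial>/\<partial>cnj \<zeta> = (\<partial>/\<partial>x + \<i> \<partial>/\<partial>y) / 2\<close> for \<open>\<zeta> = x + \<i> y\<close>.
  At points where a partial derivative does not exist the value is unspecified.
\<close>

definition partial_x :: "(complex \<Rightarrow> complex) \<Rightarrow> complex \<Rightarrow> complex" where
  "partial_x f \<zeta> = vector_derivative (\<lambda>t. f (Complex t (Im \<zeta>))) (at (Re \<zeta>))"

definition partial_y :: "(complex \<Rightarrow> complex) \<Rightarrow> complex \<Rightarrow> complex" where
  "partial_y f \<zeta> = vector_derivative (\<lambda>t. f (Complex (Re \<zeta>) t)) (at (Im \<zeta>))"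

definition wirtinger :: "(complex \<Rightarrow> complex) \<Rightarrow> complex \<Rightarrow> complex" where
  "wirtinger f \<zeta> = (partial_x f \<zeta> - \<i> * partial_y f \<zeta>) / 2"

definition wirtinger_cnj :: "(complex \<Rightarrow> complex) \<Rightarrow> complex \<Rightarrow> complex" where
  "wirtinger_cnj f \<zeta> = (partial_x f \<zeta> + \<i> * partial_y f \<zeta>) / 2"

text \<open>
  The univariate complex Hermite polynomial \<open>H\<^sub>m\<^sub>,\<^sub>n(\<zeta>, cnj \<zeta>)\<close>.  The second argument is always the
  conjugate of the first, so only \<open>\<zeta>\<close> is passed.
\<close>

definition complex_hermite :: "nat \<Rightarrow> nat \<Rightarrow> complex \<Rightarrow> complex" where
  "complex_hermite m n \<zeta> =
     (-1) ^ (m + n) * of_real (exp ((cmod \<zeta>)\<^sup>2)) *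
     (wirtinger_cnj ^^ m) ((wirtinger ^^ n) (\<lambda>u. of_real (exp (- (cmod u)\<^sup>2)))) \<zeta>"

text \<open>
  \<open>H\<^sub>m\<^sub>,\<^sub>n\<^sub>,\<^sub>m\<^sub>'\<^sub>,\<^sub>n\<^sub>'(z, w) = H\<^sub>m\<^sub>,\<^sub>n(z + \<i>w, cnj z - \<i> cnj w) H\<^sub>m\<^sub>'\<^sub>,\<^sub>n\<^sub>'(cnj z + \<i> cnj w, z - \<i>w)\<close>; in both factors
  the second argument is the conjugate of the first.
\<close>

definition complex_hermite2 :: "nat \<Rightarrow> nat \<Rightarrow> nat \<Rightarrow> nat \<Rightarrow> complex \<Rightarrow> complex \<Rightarrow> complex" where
  "complex_hermite2 m n m' n' z w =
     complex_hermite m n (z + \<i> * w) * complex_hermite m' n' (cnj z + \<i> * cnj w)"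

lemma complex_hermite2_args:
  "cnj (z + \<i> * w) = cnj z - \<i> * cnj w"
  "cnj (cnj z + \<i> * cnj w) = z - \<i> * w"
  by simp_all

text \<open>
  The \<open>(4,2)\<close>-binomial operator for \<open>M = (m,n,m',n')\<close>.  Over the range of summation none of the
  natural-number subtractions truncates.
\<close>

definition binomial_op_4_2 ::
  "nat \<Rightarrow> nat \<Rightarrow> nat \<Rightarrow> nat \<Rightarrow> (nat \<Rightarrow> nat \<Rightarrow> complex \<Rightarrow> complex) \<Rightarrow> complex \<Rightarrow> complex \<Rightarrow> complex" where
  "binomial_op_4_2 m n m' n' f z w =
     (\<Sum>j\<le>m. \<Sum>k\<le>n. \<Sum>j'\<le>m'. \<Sum>k'\<le>n'.
        (-1) ^ (k + k') * \<i> ^ (j + k + j' + k') *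
        of_nat ((m choose j) * (n choose k) * (m' choose j') * (n' choose k')) *
        f (m + n' - j - k') (m' + n - j' - k) z * f (j + k') (j' + k) w)"

end

theory Submission
  imports Defs
begin

text \<open>
  The Rodrigues formula gives \<open>H\<^sub>0\<^sub>,\<^sub>n = cnj \<zeta> ^ n\<close> and \<open>H\<^sub>m\<^sub>+\<^sub>1\<^sub>,\<^sub>n = \<zeta> H\<^sub>m\<^sub>,\<^sub>n - n H\<^sub>m\<^sub>,\<^sub>n\<^sub>-\<^sub>1\<close>.  Read the tensor
  \<open>F\<^sub>r\<^sub>,\<^sub>s\<^sub>,\<^sub>p\<^sub>,\<^sub>q = H\<^sub>r\<^sub>,\<^sub>s(Z) H\<^sub>p\<^sub>,\<^sub>q(W)\<close> as the image of \<open>x\<^sup>r y\<^sup>s u\<^sup>p v\<^sup>q\<close> under a linear functional.  By the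
  binomial theorem, the binomial operator is then the value of this functional at
  \<open>(x + \<i>u)\<^sup>m (y - \<i>v)\<^sup>n (y + \<i>v)\<^sup>m\<^sup>' (x - \<i>u)\<^sup>n\<^sup>'\<close>.  The recurrence says that multiplication by \<open>x + cu\<close> acts
  as \<open>Z + cW - (\<partial>\<^sub>y + c\<partial>\<^sub>v)\<close>.  Since \<open>\<partial>\<^sub>y \<plusminus> \<i>\<partial>\<^sub>v\<close> kills \<open>y \<plusminus> \<i>v\<close> and takes \<open>y \<mp> \<i>v\<close> to 2, both sides of
  the claim satisfy the same recurrences in \<open>m\<close> and \<open>n'\<close>, up to the scaling by \<open>sqrt 2\<close>.
\<close>

section \<open>Wirtinger derivatives as coefficients of the real derivative\<close>

lemma wirtinger_eqI:
  assumes "(f has_derivative (\<lambda>v. a * v + b * cnj v)) (at \<zeta>)"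
  shows "wirtinger f \<zeta> = a" "wirtinger_cnj f \<zeta> = b"
proof -
  have "((\<lambda>t. Complex t (Im \<zeta>)) has_derivative of_real) (at (Re \<zeta>))"
    unfolding Complex_eq by (auto intro!: derivative_eq_intros)
  from has_derivative_compose[OF this, of f "\<lambda>v. a * v + b * cnj v"] assms
  have "((\<lambda>t. f (Complex t (Im \<zeta>))) has_derivative (\<lambda>h. a * of_real h + b * cnj (of_real h)))
      (at (Re \<zeta>))"
    by simp
  then have "partial_x f \<zeta> = a + b"
    unfolding partial_x_def
    by (intro vector_derivative_at)
       (simp add: has_vector_derivative_def scaleR_conv_of_real algebra_simps)
  moreover have "((\<lambda>t. Complex (Re \<zeta>) t) has_derivative (\<lambda>h. \<i> * of_real h)) (at (Im \<zeta>))"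
    unfolding Complex_eq by (auto intro!: derivative_eq_intros)
  from has_derivative_compose[OF this, of f "\<lambda>v. a * v + b * cnj v"] assms
  have "((\<lambda>t. f (Complex (Re \<zeta>) t)) has_derivative
      (\<lambda>h. a * (\<i> * of_real h) + b * cnj (\<i> * of_real h))) (at (Im \<zeta>))"
    by simp
  then have "partial_y f \<zeta> = \<i> * (a - b)"
    unfolding partial_y_def
    by (intro vector_derivative_at)
       (simp add: has_vector_derivative_def scaleR_conv_of_real algebra_simps)
  moreover have "\<i> * (\<i> * x) = - x" for x
    by (simp flip: mult.assoc)
  ultimately show "wirtinger f \<zeta> = a" "wirtinger_cnj f \<zeta> = b"
    by (simp_all add: wirtinger_def wirtinger_cnj_def)
qed

section \<open>The Gaussian, the Rodrigues formula and the Hermite recurrences\<close>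

abbreviation gauss :: "complex \<Rightarrow> complex" where
  "gauss \<equiv> (\<lambda>u. of_real (exp (- (cmod u)\<^sup>2)))"

lemma has_derivative_gauss:
  "(gauss has_derivative (\<lambda>v. (- cnj \<zeta> * gauss \<zeta>) * v + (- \<zeta> * gauss \<zeta>) * cnj v)) (at \<zeta>)"
proof -
  have eq: "gauss = (\<lambda>u. exp (- (u * cnj u)))"
    by (simp add: fun_eq_iff exp_of_real[symmetric] complex_norm_square[symmetric])
  have "((\<lambda>u. - (u * cnj u)) has_derivative (\<lambda>v. - (\<zeta> * cnj v + v * cnj \<zeta>))) (at \<zeta>)"
    by (auto intro!: derivative_eq_intros)
  from has_derivative_compose[OF this DERIV_exp[THEN has_field_derivative_imp_has_derivative]]
  show ?thesis
    unfolding fun_cong[OF eq] by (simp add: algebra_simps)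
qed

text \<open>The polynomial factor that repeated differentiation leaves in front of the Gaussian. At
  \<open>n = 0\<close> the truncated index \<open>n - 1\<close> is harmless, since its coefficient
  is zero.\<close>

primrec hermite_poly :: "nat \<Rightarrow> nat \<Rightarrow> complex \<Rightarrow> complex" where
  "hermite_poly 0 n \<zeta> = cnj \<zeta> ^ n"
| "hermite_poly (Suc m) n \<zeta> =
     \<zeta> * hermite_poly m n \<zeta> - of_nat n * hermite_poly m (n - 1) \<zeta>"

text \<open>The recurrence in \<open>m\<close> uses only the antiholomorphic coefficient, so the
  holomorphic one stays existential.\<close>

lemma has_derivative_hermite_poly:
  "\<exists>a. (hermite_poly m n has_derivative
     (\<lambda>v. a * v + (of_nat n * hermite_poly m (n - 1) \<zeta>) * cnj v)) (at \<zeta>)"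
proof (induction m arbitrary: n)
  case 0
  have "((\<lambda>\<zeta>. cnj \<zeta> ^ n) has_derivative
      (\<lambda>v. 0 * v + (of_nat n * cnj \<zeta> ^ (n - 1)) * cnj v)) (at \<zeta>)"
    by (auto intro!: derivative_eq_intros simp: algebra_simps)
  then show ?case
    by (intro exI[of _ 0]) simp
next
  case (Suc m)
  obtain a b where
    a: "(hermite_poly m n has_derivative
      (\<lambda>v. a * v + (of_nat n * hermite_poly m (n - 1) \<zeta>) * cnj v)) (at \<zeta>)" and
    b: "(hermite_poly m (n - 1) has_derivative
      (\<lambda>v. b * v + (of_nat (n - 1) * hermite_poly m (n - 1 - 1) \<zeta>) * cnj v)) (at \<zeta>)"
    using Suc by blast
  have "((\<lambda>\<zeta>. \<zeta> * hermite_poly m n \<zeta> - of_nat n * hermite_poly m (n - 1) \<zeta>) has_derivative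
      (\<lambda>v. (hermite_poly m n \<zeta> + \<zeta> * a - of_nat n * b) * v
        + (of_nat n * hermite_poly (Suc m) (n - 1) \<zeta>) * cnj v)) (at \<zeta>)"
    by (rule derivative_eq_intros a b refl ext)+ (simp add: algebra_simps)
  then show ?case
    by (intro exI) simp
qed

lemma wirtinger_funpow_gauss:
  "(wirtinger ^^ n) gauss = (\<lambda>u. (- cnj u) ^ n * gauss u)"
proof (induction n)
  case (Suc n)
  have "wirtinger (\<lambda>u. (- cnj u) ^ n * gauss u) \<zeta> = (- cnj \<zeta>) ^ Suc n * gauss \<zeta>" for \<zeta>
  proof (rule wirtinger_eqI(1))
    show "((\<lambda>u. (- cnj u) ^ n * gauss u) has_derivative
      (\<lambda>v. ((- cnj \<zeta>) ^ Suc n * gauss \<zeta>) * v +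
        ((- of_nat n * (- cnj \<zeta>) ^ (n - 1) - \<zeta> * (- cnj \<zeta>) ^ n) * gauss \<zeta>) * cnj v)) (at \<zeta>)"
      by (rule derivative_eq_intros has_derivative_gauss refl ext)+ (simp add: algebra_simps)
  qed
  then show ?case
    by (simp add: Suc fun_eq_iff)
qed simp

text \<open>By the product rule the Gaussian contributes \<open>- \<zeta>\<close> and the polynomial
  its lowered neighbour; up to sign this is the recursion of \<open>hermite_poly\<close>.\<close>

lemma wirtinger_cnj_funpow_gauss:
  "(wirtinger_cnj ^^ m) ((wirtinger ^^ n) gauss)
    = (\<lambda>u. (-1) ^ (m + n) * hermite_poly m n u * gauss u)"
proof (induction m)
  case 0
  then show ?case
    by (simp add: wirtinger_funpow_gauss power_minus[of "cnj _"])
next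
  case (Suc m)
  have "wirtinger_cnj (\<lambda>u. (-1) ^ (m + n) * hermite_poly m n u * gauss u) \<zeta>
      = (-1) ^ (Suc m + n) * hermite_poly (Suc m) n \<zeta> * gauss \<zeta>" for \<zeta>
  proof -
    obtain a where
      a: "(hermite_poly m n has_derivative
        (\<lambda>v. a * v + (of_nat n * hermite_poly m (n - 1) \<zeta>) * cnj v)) (at \<zeta>)"
      using has_derivative_hermite_poly by blast
    have "((\<lambda>u. (-1) ^ (m + n) * hermite_poly m n u * gauss u) has_derivative
        (\<lambda>v. ((-1) ^ (m + n) * (a - cnj \<zeta> * hermite_poly m n \<zeta>) * gauss \<zeta>) * v
          + ((-1) ^ (Suc m + n) * hermite_poly (Suc m) n \<zeta> * gauss \<zeta>) * cnj v)) (at \<zeta>)"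
      by (rule derivative_eq_intros a has_derivative_gauss refl ext)+ (simp add: algebra_simps)
    then show ?thesis
      by (rule wirtinger_eqI(2))
  qed
  then show ?case
    by (simp add: Suc fun_eq_iff)
qed

lemma complex_hermite_eq_hermite_poly: "complex_hermite m n = hermite_poly m n"
proof
  fix \<zeta>
  have "complex_hermite m n \<zeta> =
      ((-1) ^ (m + n) * (-1) ^ (m + n)) * (of_real (exp ((cmod \<zeta>)\<^sup>2)) * gauss \<zeta>) *
      hermite_poly m n \<zeta>"
    unfolding complex_hermite_def wirtinger_cnj_funpow_gauss by (simp only: mult_ac)
  also have "\<dots> = hermite_poly m n \<zeta>"
    unfolding of_real_mult[symmetric] exp_add[symmetric]
    by (simp flip: power_mult_distrib)
  finally show "complex_hermite m n \<zeta> = hermite_poly m n \<zeta>" .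
qed

lemma hermite_poly_Suc_right:
  "hermite_poly m (Suc n) \<zeta> = cnj \<zeta> * hermite_poly m n \<zeta> - of_nat m * hermite_poly (m - 1) n \<zeta>"
proof (induction m arbitrary: n)
  case (Suc m)
  \<comment> \<open>The first fact is the induction hypothesis at \<open>n - 1\<close>, the second
    the defining recursion at \<open>m - 1\<close>. Both left sides equal the same lowered term, and
    the factors \<open>n\<close> and \<open>m\<close> cover the zero cases.\<close>
  have 1: "of_nat n * (cnj \<zeta> * hermite_poly m (n - 1) \<zeta> - hermite_poly m n \<zeta>)
      = of_nat n * of_nat m * hermite_poly (m - 1) (n - 1) \<zeta>"
    using Suc[of "n - 1"] by (cases n) simp_all
  have 2: "of_nat m * (\<zeta> * hermite_poly (m - 1) n \<zeta> - hermite_poly m n \<zeta>)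
      = of_nat n * of_nat m * hermite_poly (m - 1) (n - 1) \<zeta>"
    by (cases m) simp_all
  show ?case
    unfolding hermite_poly.simps diff_Suc_1 Suc of_nat_Suc using 1 2 by algebra
qed simp

section \<open>Shift and lowering operators on tensors\<close>

type_synonym tensor = "nat \<Rightarrow> nat \<Rightarrow> nat \<Rightarrow> nat \<Rightarrow> complex"

text \<open>
  These are dual to multiplication by \<open>x + c u\<close>, multiplication by \<open>y + c v\<close> and the derivation
  \<open>\<partial>\<^sub>y + c \<partial>\<^sub>v\<close> on polynomials in \<open>x, y, u, v\<close>.
\<close>

definition shift_x :: "complex \<Rightarrow> tensor \<Rightarrow> tensor" where
  "shift_x c F = (\<lambda>r s p q. F (Suc r) s p q + c * F r s (Suc p) q)"

definition shift_y :: "complex \<Rightarrow> tensor \<Rightarrow> tensor" where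
  "shift_y c F = (\<lambda>r s p q. F r (Suc s) p q + c * F r s p (Suc q))"

definition lower_y :: "complex \<Rightarrow> tensor \<Rightarrow> tensor" where
  "lower_y c F = (\<lambda>r s p q. of_nat s * F r (s - 1) p q + c * of_nat q * F r s p (q - 1))"

definition tensor_lin :: "complex \<Rightarrow> tensor \<Rightarrow> complex \<Rightarrow> tensor \<Rightarrow> tensor" where
  "tensor_lin a F b G = (\<lambda>r s p q. a * F r s p q + b * G r s p q)"

lemma funpow_commute:
  assumes "\<And>x. f (g x) = g (f x)"
  shows "(f ^^ m) ((g ^^ n) x) = (g ^^ n) ((f ^^ m) x)"
proof -
  have "f ((g ^^ n) x) = (g ^^ n) (f x)" for x
    by (induction n) (simp_all add: assms)
  then show ?thesis
    by (induction m) simp_all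
qed

lemma shift_x_shift_x: "shift_x c (shift_x d F) = shift_x d (shift_x c F)"
  by (simp add: shift_x_def fun_eq_iff algebra_simps)

lemma shift_x_shift_y: "shift_x c (shift_y d F) = shift_y d (shift_x c F)"
  by (simp add: shift_x_def shift_y_def fun_eq_iff algebra_simps)

lemma shift_x_lower_y: "shift_x c (lower_y d F) = lower_y d (shift_x c F)"
  by (simp add: shift_x_def lower_y_def fun_eq_iff algebra_simps)

text \<open>Dual to the Leibniz rule: \<open>\<partial>\<^sub>y + c \<partial>\<^sub>v\<close> takes
  \<open>y + d v\<close> to \<open>1 + c * d\<close>. For \<open>c, d\<close> among
  \<open>\<i>, -\<i>\<close> this is 0 if \<open>c = d\<close> and 2 otherwise.\<close>

lemma shift_y_lower_y:
  "shift_y d (lower_y c F) = tensor_lin 1 (lower_y c (shift_y d F)) (1 + c * d) F"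
proof -
  have "shift_y d (lower_y c F) r s p q =
      tensor_lin 1 (lower_y c (shift_y d F)) (1 + c * d) F r s p q" for r s p q
    by (cases s; cases q) (simp_all add: shift_y_def lower_y_def tensor_lin_def algebra_simps)
  then show ?thesis
    by blast
qed

lemma funpow_shift_x_lin:
  "(shift_x c ^^ n) (tensor_lin a F b G)
    = tensor_lin a ((shift_x c ^^ n) F) b ((shift_x c ^^ n) G)"
  by (induction n) (simp_all add: tensor_lin_def shift_x_def fun_eq_iff algebra_simps)

lemma funpow_shift_y_lin:
  "(shift_y c ^^ n) (tensor_lin a F b G)
    = tensor_lin a ((shift_y c ^^ n) F) b ((shift_y c ^^ n) G)"
  by (induction n) (simp_all add: tensor_lin_def shift_y_def fun_eq_iff algebra_simps)

lemma funpow_shift_y_lower_y: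
  "(shift_y d ^^ n) (lower_y c F) =
    tensor_lin 1 (lower_y c ((shift_y d ^^ n) F)) (of_nat n * (1 + c * d)) ((shift_y d ^^ (n - 1)) F)"
proof (induction n)
  case (Suc n)
  have "(shift_y d ^^ Suc n) (lower_y c F) =
      tensor_lin 1 (shift_y d (lower_y c ((shift_y d ^^ n) F)))
        (of_nat n * (1 + c * d)) (shift_y d ((shift_y d ^^ (n - 1)) F))"
    using funpow_shift_y_lin[of 1 d] by (simp add: Suc)
  also have "\<dots> = tensor_lin 1 (lower_y c ((shift_y d ^^ Suc n) F))
      (of_nat (Suc n) * (1 + c * d)) ((shift_y d ^^ n) F)"
    by (cases n) (simp_all add: shift_y_lower_y tensor_lin_def fun_eq_iff algebra_simps)
  finally show ?case
    by simp
qed (simp add: tensor_lin_def)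

lemma lower_y_at_0 [simp]: "lower_y c F r 0 p 0 = 0"
  by (simp add: lower_y_def)

text \<open>Once \<open>lower_y\<close> is moved outside both powers it vanishes at the zero
  indices, where it differentiates a constant; only the commutators remain.\<close>

lemma shift_y_pair_lower_y_at_0:
  "(shift_y d ^^ n) ((shift_y e ^^ m) (lower_y c F)) 0 0 0 0 =
    of_nat n * (1 + c * d) * (shift_y d ^^ (n - 1)) ((shift_y e ^^ m) F) 0 0 0 0 +
    of_nat m * (1 + c * e) * (shift_y d ^^ n) ((shift_y e ^^ (m - 1)) F) 0 0 0 0"
  unfolding funpow_shift_y_lower_y funpow_shift_y_lin by (simp add: tensor_lin_def)

section \<open>Binomial expansion of iterated shifts and of the operator\<close>

lemma sum_binomial_Suc:
  fixes g :: "nat \<Rightarrow> nat \<Rightarrow> complex"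
  shows "(\<Sum>k\<le>Suc n. of_nat (Suc n choose k) * d ^ k * g (Suc n - k) k)
    = (\<Sum>k\<le>n. of_nat (n choose k) * d ^ k * (g (Suc (n - k)) k + d * g (n - k) (Suc k)))"
proof -
  have "(\<Sum>k\<le>Suc n. of_nat (Suc n choose k) * d ^ k * g (Suc n - k) k)
      = (g (Suc n) 0 + (\<Sum>k\<le>n. of_nat (n choose Suc k) * d ^ Suc k * g (n - k) (Suc k)))
        + (\<Sum>k\<le>n. of_nat (n choose k) * d ^ k * (d * g (n - k) (Suc k)))"
    unfolding sum.atMost_Suc_shift[of _ n] by (simp add: algebra_simps sum.distrib)
  \<comment> \<open>Pascal's rule has split the sum; this half is shifted back. Its new top term
    \<open>k = Suc n\<close> has binomial coefficient 0 and drops out next.\<close>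
  also have "g (Suc n) 0 + (\<Sum>k\<le>n. of_nat (n choose Suc k) * d ^ Suc k * g (n - k) (Suc k))
      = (\<Sum>k\<le>Suc n. of_nat (n choose k) * d ^ k * g (Suc n - k) k)"
    unfolding sum.atMost_Suc_shift[of _ n] by simp
  also have "\<dots> = (\<Sum>k\<le>n. of_nat (n choose k) * d ^ k * g (Suc (n - k)) k)"
    by (simp add: Suc_diff_le)
  finally show ?thesis
    by (simp add: sum.distrib ring_distribs)
qed

lemma funpow_shift_x_expand:
  "(shift_x c ^^ n) F r s p q
    = (\<Sum>k\<le>n. of_nat (n choose k) * c ^ k * F (r + (n - k)) s (p + k) q)"
proof (induction n arbitrary: F)
  case (Suc n)
  have "(shift_x c ^^ Suc n) F r s p q = (shift_x c ^^ n) (shift_x c F) r s p q"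
    by (simp add: funpow_swap1)
  also have "\<dots> = (\<Sum>k\<le>n. of_nat (n choose k) * c ^ k *
      (F (r + Suc (n - k)) s (p + k) q + c * F (r + (n - k)) s (p + Suc k) q))"
    unfolding Suc by (simp add: shift_x_def)
  finally show ?case
    using sum_binomial_Suc[of n c "\<lambda>a b. F (r + a) s (p + b) q"] by (simp only:)
qed simp

lemma funpow_shift_y_expand:
  "(shift_y c ^^ n) F r s p q
    = (\<Sum>k\<le>n. of_nat (n choose k) * c ^ k * F r (s + (n - k)) p (q + k))"
proof (induction n arbitrary: F)
  case (Suc n)
  have "(shift_y c ^^ Suc n) F r s p q = (shift_y c ^^ n) (shift_y c F) r s p q"
    by (simp add: funpow_swap1)
  also have "\<dots> = (\<Sum>k\<le>n. of_nat (n choose k) * c ^ k *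
      (F r (s + Suc (n - k)) p (q + k) + c * F r (s + (n - k)) p (q + Suc k)))"
    unfolding Suc by (simp add: shift_y_def)
  finally show ?case
    using sum_binomial_Suc[of n c "\<lambda>a b. F r (s + a) p (q + b)"] by (simp only:)
qed simp

text \<open>The four powers commute. In this order the \<open>x\<close> shifts meet the Hermite
  recurrence directly at \<open>F\<close>, and the \<open>y\<close> shifts stay outside to absorb
  the resulting \<open>lower_y\<close>.\<close>

definition shift_all :: "nat \<Rightarrow> nat \<Rightarrow> nat \<Rightarrow> nat \<Rightarrow> tensor \<Rightarrow> tensor" where
  "shift_all m n m' n' F =
    (shift_y (-\<i>) ^^ n) ((shift_y \<i> ^^ m') ((shift_x \<i> ^^ m) ((shift_x (-\<i>) ^^ n') F)))"

lemma binomial_op_4_2_eq_shift_all: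
  "binomial_op_4_2 m n m' n' f z w = shift_all m n m' n' (\<lambda>r s p q. f r s z * f p q w) 0 0 0 0"
proof -
  define F :: tensor where "F = (\<lambda>r s p q. f r s z * f p q w)"
  \<comment> \<open>Reordered so that expanding from the outside nests the sums as \<open>j\<close>,
    \<open>k\<close>, \<open>j'\<close>, \<open>k'\<close>.\<close>
  have "shift_all m n m' n' F =
      (shift_x \<i> ^^ m) ((shift_y (-\<i>) ^^ n) ((shift_y \<i> ^^ m') ((shift_x (-\<i>) ^^ n') F)))"
    unfolding shift_all_def by (simp add: funpow_commute shift_x_shift_y)
  then have "shift_all m n m' n' F 0 0 0 0 =
      (\<Sum>j\<le>m. \<Sum>k\<le>n. \<Sum>j'\<le>m'. \<Sum>k'\<le>n'.
        of_nat (m choose j) * \<i> ^ j * (of_nat (n choose k) * (-\<i>) ^ k *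
        (of_nat (m' choose j') * \<i> ^ j' * (of_nat (n' choose k') * (-\<i>) ^ k' *
        F (m - j + (n' - k')) (n - k + (m' - j')) (j + k') (k + j')))))"
    by (simp only: funpow_shift_x_expand funpow_shift_y_expand sum_distrib_left add_0)
  also have "\<dots> = binomial_op_4_2 m n m' n' f z w"
    unfolding binomial_op_4_2_def
  proof (intro sum.cong refl)
    fix j k j' k' assume "j \<in> {..m}" "k \<in> {..n}" "j' \<in> {..m'}" "k' \<in> {..n'}"
    then have "m + n' - j - k' = m - j + (n' - k')" "m' + n - j' - k = n - k + (m' - j')"
      by auto
    then show "of_nat (m choose j) * \<i> ^ j * (of_nat (n choose k) * (-\<i>) ^ k *
        (of_nat (m' choose j') * \<i> ^ j' * (of_nat (n' choose k') * (-\<i>) ^ k' *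
        F (m - j + (n' - k')) (n - k + (m' - j')) (j + k') (k + j')))) =
      (-1) ^ (k + k') * \<i> ^ (j + k + j' + k') *
        of_nat ((m choose j) * (n choose k) * (m' choose j') * (n' choose k')) *
        f (m + n' - j - k') (m' + n - j' - k) z * f (j + k') (j' + k) w"
      by (simp add: F_def power_add power_minus[of \<i>] add.commute[of k j'])
  qed
  finally show ?thesis
    by (simp add: F_def)
qed

section \<open>Evaluation on the Hermite tensor\<close>

lemma shift_x_hermite:
  fixes Z W :: complex
  defines "F \<equiv> (\<lambda>r s p q. hermite_poly r s Z * hermite_poly p q W)"
  shows "shift_x c F = tensor_lin (Z + c * W) F (-1) (lower_y c F)"
  by (simp add: F_def shift_x_def tensor_lin_def lower_y_def fun_eq_iff algebra_simps)

lemma shift_all_hermite: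
  fixes z w :: complex
  defines "F \<equiv> (\<lambda>r s p q.
    hermite_poly r s (of_real (sqrt 2) * z) * hermite_poly p q (of_real (sqrt 2) * w))"
  shows "shift_all m n m' n' F 0 0 0 0 = of_real (sqrt 2) ^ (m + n + m' + n') *
    (hermite_poly m n (z + \<i> * w) * hermite_poly m' n' (cnj z + \<i> * cnj w))"
proof -
  let ?t = "of_real (sqrt 2) :: complex"
  let ?R = "\<lambda>m n m' n'. shift_all m n m' n' F 0 0 0 0"
  have tt: "?t * ?t = 2" "?t * (?t * x) = 2 * x" for x
    by (simp_all flip: of_real_mult mult.assoc)
  have F: "shift_x c F = tensor_lin (?t * (z + c * w)) F (-1) (lower_y c F)" for c
    unfolding F_def shift_x_hermite by (simp add: ring_distribs mult_ac)
  have lower: "(shift_x c ^^ k) (lower_y d G) = lower_y d ((shift_x c ^^ k) G)" for c d k G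
    using funpow_commute[of "shift_x c" "lower_y d" k 1 G] by (simp add: shift_x_lower_y)
  \<comment> \<open>Here \<open>c = \<i>\<close>: the commutator is 2 with the \<open>n\<close>
    shifts by \<open>-\<i>\<close> and 0 with the \<open>m'\<close> shifts by \<open>\<i>\<close>.
    In \<open>step_n'\<close> the roles swap.\<close>
  have step_m: "?R (Suc m) n m' n' =
      ?t * (z + \<i> * w) * ?R m n m' n' - 2 * of_nat n * ?R m (n - 1) m' n'" for m n m' n'
  proof -
    have *: "(shift_x \<i> ^^ Suc m) ((shift_x (-\<i>) ^^ n') F)
        = (shift_x \<i> ^^ m) ((shift_x (-\<i>) ^^ n') (shift_x \<i> F))"
      using funpow_commute[of "shift_x \<i>" "shift_x (-\<i>)" 1 n' F]
      by (simp add: shift_x_shift_x funpow_swap1)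
    show ?thesis
      unfolding shift_all_def * F funpow_shift_x_lin funpow_shift_y_lin lower
      by (simp add: tensor_lin_def shift_y_pair_lower_y_at_0)
  qed
  have step_n': "?R m n m' (Suc n') =
      ?t * (z - \<i> * w) * ?R m n m' n' - 2 * of_nat m' * ?R m n (m' - 1) n'" for m n m' n'
  proof -
    have *: "(shift_x (-\<i>) ^^ Suc n') F = (shift_x (-\<i>) ^^ n') (shift_x (-\<i>) F)"
      by (simp add: funpow_swap1)
    show ?thesis
      unfolding shift_all_def * F funpow_shift_x_lin funpow_shift_y_lin lower
      by (simp add: tensor_lin_def shift_y_pair_lower_y_at_0)
  qed
  have base: "?R 0 n m' 0 = ?t ^ (n + m') *
      (hermite_poly 0 n (z + \<i> * w) * hermite_poly m' 0 (cnj z + \<i> * cnj w))" for n m'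
  proof -
    \<comment> \<open>For \<open>r = p = 0\<close> the tensor \<open>F\<close> consists of pure
      powers of conjugates, so a \<open>y\<close> shift acts as a scalar. The factor
      \<open>a\<close> allows a second use, on the already shifted \<open>F\<close>.\<close>
    have *: "(shift_y c ^^ k) G 0 s 0 q = (?t * (cnj z + c * cnj w)) ^ k * a * F 0 s 0 q"
      if "\<And>s q. G 0 s 0 q = a * F 0 s 0 q" for c k s q a G
    proof (induction k arbitrary: s q)
      case (Suc k)
      let ?b = "?t * (cnj z + c * cnj w)"
      have "(shift_y c ^^ Suc k) G 0 s 0 q =
          (shift_y c ^^ k) G 0 (Suc s) 0 q + c * (shift_y c ^^ k) G 0 s 0 (Suc q)"
        by (simp add: shift_y_def)
      also have "\<dots> = ?b ^ k * a * (F 0 (Suc s) 0 q + c * F 0 s 0 (Suc q))"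
        unfolding Suc by (simp only: ring_distribs mult_ac)
      also have "F 0 (Suc s) 0 q + c * F 0 s 0 (Suc q) = ?b * F 0 s 0 q"
        by (simp add: F_def algebra_simps)
      finally show ?case
        by (simp only: power_Suc mult_ac)
    qed (use that in simp)
    have "(shift_y \<i> ^^ m') F 0 s 0 q = (?t * (cnj z + \<i> * cnj w)) ^ m' * F 0 s 0 q" for s q
      using *[of F 1] by simp
    from *[of "(shift_y \<i> ^^ m') F", OF this, of n "-\<i>" 0 0] have "?R 0 n m' 0 =
        (?t * (cnj z - \<i> * cnj w)) ^ n * (?t * (cnj z + \<i> * cnj w)) ^ m'"
      by (simp add: shift_all_def F_def)
    moreover have "hermite_poly k 0 \<zeta> = \<zeta> ^ k" for k \<zeta>
      by (induction k) simp_all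
    ultimately show ?thesis
      by (simp add: power_add power_mult_distrib mult_ac)
  qed
  show ?thesis
  proof (induction n' arbitrary: m')
    case 0
    show ?case
    proof (induction m arbitrary: n)
      case 0
      show ?case using base by simp
    next
      case (Suc m)
      show ?case
        \<comment> \<open>The lowered term has total degree two less; its factor 2 is
          \<open>?t * ?t\<close>, which restores the power of \<open>?t\<close>.\<close>
        unfolding step_m Suc by (cases n) (simp_all add: algebra_simps tt)
    qed
  next
    case (Suc n')
    show ?case
      \<comment> \<open>The recurrence in the second index applies at
        \<open>cnj z + \<i> * cnj w\<close>, whose conjugate is the factor
        \<open>z - \<i> * w\<close>.\<close>
      unfolding step_n' Suc by (cases m') (simp_all add: hermite_poly_Suc_right algebra_simps tt)
  qed
qed

theorem theorem3p14:
  fixes m n m' n' :: nat and z w :: complex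
  shows "complex_hermite2 m n m' n' z w =
    1 / of_real (sqrt 2) ^ (m + n + m' + n') *
    binomial_op_4_2 m n m' n' complex_hermite (of_real (sqrt 2) * z) (of_real (sqrt 2) * w)"
  unfolding complex_hermite2_def binomial_op_4_2_eq_shift_all complex_hermite_eq_hermite_poly
    shift_all_hermite
  by simp

end
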